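(* Let $N\ge1$ and let $A$ be a positive semidefinite $N\times N$ matrix with entries in $[0,\infty)$. Suppose the rows of $A$ are distinct. Then there exists a vector $\mathbf{u}\in[0,\infty)^N$ with distinct entries such that $A\ge\mathbf{u}\mathbf{u}^T$ and $\mathbf{u}$ has a zero entry if and only if $A$ has a zero row.
   Context: $A\ge B$ (Loewner order) for Hermitian matrices means that $A-B$ is positive semidefinite. Positive semidefinite matrices are Hermitian, so $A$ here is real symmetric. Vectors are column vectors. *)

theory Defs
  imports "HOL-Analysis.Analysis"
begin

text \<open>
  Positive semidefinite includes Hermitian, which for real matrices means symmetric. It is a
  separate conjunct because over the reals it does not follow from nonnegativity of the
  quadratic form.
\<close>

definition psd :: "real ^ 'n ^ 'n \<Rightarrow> bool" where
  "psd A \<longleftrightarrow> transpose A = A \<and> (\<forall>x. 0 \<le> x \<bullet> (A *v x))"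

definition loewner_ge :: "real ^ 'n ^ 'n \<Rightarrow> real ^ 'n ^ 'n \<Rightarrow> bool" where
  "loewner_ge A B \<longleftrightarrow> psd (A - B)"

end

theory Submission
  imports Defs
begin

text \<open>
  Every vector \<open>A x\<close> in the range of a positive semidefinite \<open>A\<close> can be scaled to a vector
  \<open>u\<close> with \<open>A \<ge> u u\<^sup>T\<close>: by the Cauchy--Schwarz inequality for the form of \<open>A\<close>, it suffices
  that the squared scaling factor times \<open>x \<bullet> A x\<close> is at most 1
  (\<open>loewner_ge_rank_one_of_range\<close>). So only \<open>x\<close> has to be chosen well. The entries
  of \<open>A x\<close> are the inner products of \<open>x\<close> with the rows. They are distinct as soon as \<open>x\<close>
  avoids the finitely many hyperplanes orthogonal to the differences of two rows, and these do
  not cover the open positive orthant (\<open>ex_positive_vector_separating\<close>). If moreover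
  all entries of \<open>x\<close> are positive, then, the rows being nonnegative, an entry of \<open>A x\<close> is
  nonnegative, and it vanishes exactly when the row does.
\<close>

text \<open>
  The quadratic form at \<open>y - (b / s) x\<close>, where \<open>b = y \<bullet> A x\<close>, is nonnegative. Admitting any
  positive upper bound \<open>s\<close> of \<open>x \<bullet> A x\<close> covers the degenerate case \<open>x \<bullet> A x = 0\<close> as well.
\<close>

lemma psd_Cauchy_Schwarz:
  fixes A :: "real ^ 'n ^ 'n"
  assumes "psd A" and "s > 0" and "x \<bullet> (A *v x) \<le> s"
  shows "(y \<bullet> (A *v x))\<^sup>2 / s \<le> y \<bullet> (A *v y)"
proof -
  define b where "b = y \<bullet> (A *v x)"
  define t where "t = b / s"
  have symm: "x \<bullet> (A *v y) = b"
    using assms(1) unfolding psd_def b_def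
    by (metis dot_lmul_matrix inner_commute transpose_matrix_vector)
  have "0 \<le> (y - t *\<^sub>R x) \<bullet> (A *v (y - t *\<^sub>R x))"
    using assms(1) by (simp add: psd_def)
  also have "\<dots> = y \<bullet> (A *v y) - 2 * t * b + t\<^sup>2 * (x \<bullet> (A *v x))"
    using symm
    by (simp add: matrix_vector_mult_diff_distrib matrix_vector_mult_scaleR inner_diff_left
        inner_diff_right b_def power2_eq_square algebra_simps)
  also have "\<dots> \<le> y \<bullet> (A *v y) - 2 * t * b + t\<^sup>2 * s"
    using assms(3) by (simp add: mult_left_mono)
  also have "\<dots> = y \<bullet> (A *v y) - b\<^sup>2 / s"
    using assms(2) by (simp add: t_def power2_eq_square field_simps)
  finally show ?thesis by (simp add: b_def)
qed

lemma columnvector_mult_transpose_nth: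
  "((columnvector u :: real ^ 1 ^ 'n) ** transpose (columnvector u)) $ i $ j = u $ i * u $ j"
  by (simp add: matrix_matrix_mult_def columnvector_def transpose_def)

lemma columnvector_mult_transpose_vector:
  "((columnvector u :: real ^ 1 ^ 'n) ** transpose (columnvector u)) *v y = (u \<bullet> y) *\<^sub>R u"
  by (simp add: vec_eq_iff matrix_vector_mult_def columnvector_mult_transpose_nth inner_vec_def
      sum_distrib_left mult_ac)

lemma loewner_ge_rank_one_of_range:
  fixes A :: "real ^ 'n ^ 'n"
  assumes "psd A" and "s > 0" and "x \<bullet> (A *v x) \<le> s"
    and u: "u = (1 / sqrt s) *\<^sub>R (A *v x)"
  shows "loewner_ge A ((columnvector u :: real ^ 1 ^ 'n) ** transpose (columnvector u))"
proof -
  let ?U = "(columnvector u :: real ^ 1 ^ 'n) ** transpose (columnvector u)"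
  have "transpose ?U = ?U"
    by (simp add: matrix_transpose_mul)
  then have "transpose (A - ?U) = A - ?U"
    using assms(1) by (simp add: psd_def vec_eq_iff transpose_def)
  moreover have "0 \<le> y \<bullet> ((A - ?U) *v y)" for y
  proof -
    have "y \<bullet> ((A - ?U) *v y) = y \<bullet> (A *v y) - (y \<bullet> u)\<^sup>2"
      by (simp add: matrix_vector_mult_diff_rdistrib columnvector_mult_transpose_vector
          inner_diff_right power2_eq_square inner_commute)
    also have "(y \<bullet> u)\<^sup>2 = (y \<bullet> (A *v x))\<^sup>2 / s"
      using assms(2) by (simp add: u power_divide)
    finally show ?thesis
      using psd_Cauchy_Schwarz[OF assms(1-3), of y] by simp
  qed
  ultimately show ?thesis
    by (simp add: loewner_ge_def psd_def)
qed

text \<open>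
  A hyperplane is a null set, so finitely many of them cannot cover the nonempty open cube
  \<open>(0, 1)\<^sup>n\<close>.
\<close>

lemma ex_positive_vector_separating:
  fixes r :: "'i::finite \<Rightarrow> real ^ 'n"
  assumes "inj r"
  shows "\<exists>x :: real ^ 'n. (\<forall>k. x $ k > 0) \<and> inj (\<lambda>i. r i \<bullet> x)"
proof -
  define H where "H = (\<Union>(i, j) \<in> {(i, j). i \<noteq> j}. {x. (r i - r j) \<bullet> x = 0})"
  have "negligible H"
    unfolding H_def using assms
    by (intro negligible_Union) (auto intro!: negligible_hyperplane dest: injD)
  moreover have "\<not> negligible (box 0 (1 :: real ^ 'n))"
    by (rule open_not_negligible)
      (auto simp: box_ne_empty Basis_vec_def inner_axis)
  ultimately obtain x where "x \<in> box 0 (1 :: real ^ 'n)" and "x \<notin> H"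
    using negligible_subset by blast
  then have "\<forall>k. x $ k > 0" and "inj (\<lambda>i. r i \<bullet> x)"
    by (auto simp: mem_box_cart H_def inj_def inner_diff_left)
  then show ?thesis by blast
qed

theorem theorem2p12:
  fixes A :: "real ^ 'n ^ 'n"
  assumes "psd A"
    and "\<And>i j. A $ i $ j \<ge> 0"
    and "inj (\<lambda>i. row i A)"
  shows "\<exists>u :: real ^ 'n.
           (\<forall>i. u $ i \<ge> 0) \<and>
           inj (\<lambda>i. u $ i) \<and>
           loewner_ge A ((columnvector u :: real ^ 1 ^ 'n) ** transpose (columnvector u)) \<and>
           ((\<exists>i. u $ i = 0) \<longleftrightarrow> (\<exists>i. row i A = 0))"
proof -
  obtain x :: "real ^ 'n" where pos: "\<And>k. x $ k > 0" and sep: "inj (\<lambda>i. row i A \<bullet> x)"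
    using ex_positive_vector_separating[OF assms(3)] by blast
  \<comment> \<open>The summand 1 keeps the scaling factor defined when \<open>A x = 0\<close>.\<close>
  define s where "s = 1 + x \<bullet> (A *v x)"
  have "s > 0" and le: "x \<bullet> (A *v x) \<le> s"
    using assms(1) by (auto simp: s_def psd_def add_pos_nonneg)
  define u where "u = (1 / sqrt s) *\<^sub>R (A *v x)"
  have u_nth: "u $ i = (row i A \<bullet> x) / sqrt s" for i
    by (simp add: u_def matrix_vector_mul_component row_def)
  have row_sum: "row i A \<bullet> x = (\<Sum>k\<in>UNIV. A $ i $ k * x $ k)" for i
    by (simp add: inner_vec_def row_def)
  have term_nonneg: "A $ i $ k * x $ k \<ge> 0" for i k
    using assms(2) pos[of k] by simp
  have "u $ i \<ge> 0" for i
    using \<open>s > 0\<close> term_nonneg by (simp add: u_nth row_sum sum_nonneg)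
  moreover have "inj (\<lambda>i. u $ i)"
    using sep \<open>s > 0\<close> by (simp add: u_nth inj_def)
  moreover have "loewner_ge A ((columnvector u :: real ^ 1 ^ 'n) ** transpose (columnvector u))"
    using loewner_ge_rank_one_of_range[OF assms(1) \<open>s > 0\<close> le u_def] .
  moreover have "u $ i = 0 \<longleftrightarrow> row i A = 0" for i
  proof -
    have "u $ i = 0 \<longleftrightarrow> (\<forall>k. A $ i $ k * x $ k = 0)"
      using \<open>s > 0\<close> term_nonneg by (simp add: u_nth row_sum sum_nonneg_eq_0_iff)
    also have "\<dots> \<longleftrightarrow> row i A = 0"
      using pos by (auto simp: row_def vec_eq_iff less_le)
    finally show ?thesis .
  qed
  ultimately show ?thesis by blast
qed

end
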